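(* Let $G$ be a finite group. The cyclic subgroup graph $\Gamma(G)$ is a cograph if and only if $\Gamma(G)$ is a star graph, a path with three vertices, or a cycle with four vertices.
   Context: For a finite group $G$, the cyclic subgroup graph $\Gamma(G)$ is the simple undirected graph whose vertex set is $C(G)$, the set of all cyclic subgroups of $G$ (including the trivial subgroup $\{e\}$), and in which two distinct vertices are adjacent if and only if one of them, $H_1$, is contained in the other, $H_2$, and there is no subgroup $K$ of $G$ with $H_1<K<H_2$ (strict inclusions). A cograph is a graph that contains no induced path on four vertices. A star graph is a graph $K_{1,n}$ with $n\ge0$ (so a single vertex and a single edge count as stars). *)

theory Defs
  imports "HOL-Algebra.Elementary_Groups" "Graph_Theory.Graph_Theory"
begin

text \<open>
  A finite simple undirected graph is a \<^locale>\<open>graph\<close> of the Graph_Theory entry: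
  a symmetric loop-free digraph without parallel arcs, each undirected edge being a pair of
  opposite arcs.  Hence every adjacency relation below is symmetric.
\<close>

definition cyclic_subgroups :: "('a, 'b) monoid_scheme \<Rightarrow> 'a set set" where
  "cyclic_subgroups G = {H. subgroup H G \<and> cyclic_group (G\<lparr>carrier := H\<rparr>)}"

text \<open>The intermediate subgroup \<open>K\<close> ranges over all subgroups of \<open>G\<close>, cyclic or not.\<close>

definition covers_subgroup :: "('a, 'b) monoid_scheme \<Rightarrow> 'a set \<Rightarrow> 'a set \<Rightarrow> bool" where
  "covers_subgroup G H1 H2 \<longleftrightarrow> H1 \<subset> H2 \<and> \<not> (\<exists>K. subgroup K G \<and> H1 \<subset> K \<and> K \<subset> H2)"

definition cyclic_subgroup_graph :: "('a, 'b) monoid_scheme \<Rightarrow> 'a set pair_pre_digraph" where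
  "cyclic_subgroup_graph G =
     \<lparr> pverts = cyclic_subgroups G,
       parcs = {(H1, H2). H1 \<in> cyclic_subgroups G \<and> H2 \<in> cyclic_subgroups G \<and> H1 \<noteq> H2 \<and>
                  (covers_subgroup G H1 H2 \<or> covers_subgroup G H2 H1)} \<rparr>"

definition path_graph :: "nat \<Rightarrow> ('v, 'e) pre_digraph \<Rightarrow> bool" where
  "path_graph n \<Gamma> \<longleftrightarrow> graph \<Gamma> \<and>
     (\<exists>xs. distinct xs \<and> length xs = n \<and> verts \<Gamma> = set xs \<and>
        arcs_ends \<Gamma> = {(xs ! i, xs ! j) | i j. i < n \<and> j < n \<and> (j = Suc i \<or> i = Suc j)})"

definition cycle_graph :: "nat \<Rightarrow> ('v, 'e) pre_digraph \<Rightarrow> bool" where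
  "cycle_graph n \<Gamma> \<longleftrightarrow> 3 \<le> n \<and> graph \<Gamma> \<and>
     (\<exists>xs. distinct xs \<and> length xs = n \<and> verts \<Gamma> = set xs \<and>
        arcs_ends \<Gamma> = {(xs ! i, xs ! j) | i j.
          i < n \<and> j < n \<and> (j = Suc i mod n \<or> i = Suc j mod n)})"

text \<open>The case \<open>n = 0\<close> is the graph with a single vertex.\<close>

definition star_graph :: "('v, 'e) pre_digraph \<Rightarrow> bool" where
  "star_graph \<Gamma> \<longleftrightarrow> (\<exists>n. K\<^bsub>1,n\<^esub> \<Gamma>)"

definition cograph :: "('v, 'e) pre_digraph \<Rightarrow> bool" where
  "cograph \<Gamma> \<longleftrightarrow> graph \<Gamma> \<and> \<not> (\<exists>P. induced_subgraph P \<Gamma> \<and> path_graph 4 P)"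

lemma graph_cyclic_subgroup_graph:
  assumes "finite (carrier G)"
  shows "graph (cyclic_subgroup_graph G)"
proof -
  have "cyclic_subgroups G \<subseteq> Pow (carrier G)"
    by (auto simp: cyclic_subgroups_def dest: subgroup.subset)
  then have fin: "finite (cyclic_subgroups G)"
    using assms finite_subset by blast
  have "parcs (cyclic_subgroup_graph G) \<subseteq> cyclic_subgroups G \<times> cyclic_subgroups G"
    by (auto simp: cyclic_subgroup_graph_def)
  then have fin': "finite (parcs (cyclic_subgroup_graph G))"
    using fin finite_subset by blast
  show ?thesis
    by unfold_locales
      (use fin fin' in \<open>auto simp: cyclic_subgroup_graph_def arc_to_ends_def symmetric_def sym_def\<close>)
qed

end

theory Submission
  imports Defs "HOL-Algebra.Multiplicative_Group" "HOL-Computational_Algebra.Primes"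
begin

text \<open>
  Inside a cyclic group a subgroup is determined by its order, every divisor of the group order
  is the order of a subgroup, and inclusion is divisibility of orders.  Hence a cyclic subgroup
  \<open>K\<close> covers a cyclic subgroup \<open>H\<close> exactly when \<open>H \<subseteq> K\<close> and \<open>K\<close> has prime index over \<open>H\<close>
  (\<open>covers_subgroup_iff\<close>), so adjacency in the graph can be read off from inclusions and orders.

  A graph is a cograph iff no four vertices \<open>a, b, c, d\<close> span an induced path in this order
  (\<open>cographI\<close>, \<open>cograph_no_induced_path\<close>).  Stars, the path on three vertices and the cycle on four
  vertices visibly have no such path.  The path on three vertices is itself a star, so for the
  converse it suffices to find a star or a 4-cycle.

  Conversely, suppose the graph is a cograph.  If all nontrivial cyclic subgroups have prime order,
  the graph is a star with centre the trivial subgroup.  Otherwise there are cyclic subgroups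
  \<open>A \<subseteq> B\<close> of orders \<open>p\<close> and \<open>p * r\<close> with \<open>p\<close>, \<open>r\<close> prime.  A subgroup \<open>D\<close> of prime order not
  contained in \<open>B\<close> would give the induced path \<open>D, 1, A, B\<close>, so \<open>B\<close> contains every subgroup of
  prime order (\<open>prime_order_subset\<close>).  In particular there is at most one of each prime order, and
  \<open>p\<close> and \<open>r\<close> are the only primes dividing orders of cyclic subgroups.

  If \<open>p = r\<close>, a cyclic subgroup of order \<open>p\<close> cubed would contain an induced path as the chain of
  its subgroups (\<open>no_cube\<close>), so all orders are \<open>1\<close>, \<open>p\<close> or \<open>p * p\<close>, and the graph is a star with
  centre \<open>A\<close>.  If \<open>p \<noteq> r\<close>, let \<open>D\<close> be the subgroup of order \<open>r\<close>.  A cyclic subgroup \<open>K\<close> of order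
  \<open>p * p\<close> would give the induced path \<open>K, A, 1, D\<close>, and symmetrically for \<open>r * r\<close> (\<open>no_square\<close>);
  so all orders divide \<open>p * r\<close>.  Since \<open>B\<close> is the only cyclic subgroup of order \<open>p * r\<close>, the
  vertices are \<open>1\<close>, \<open>A\<close>, \<open>B\<close>, \<open>D\<close>, and the graph is the 4-cycle \<open>1, A, B, D\<close>.
\<close>

section \<open>Graphs without induced paths on four vertices\<close>

lemma less_4: "i < 4 \<longleftrightarrow> i = 0 \<or> i = 1 \<or> i = 2 \<or> i = (3::nat)" by auto

lemma path_4_index_iff: "i < 4 \<and> j < 4 \<and> (j = Suc i \<or> i = Suc j) \<longleftrightarrow>
        (i, j) \<in> {(0, 1), (1, 0), (1, 2), (2, 1), (2, 3), (3, 2 :: nat)}"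
  by (simp add: less_4) presburger

lemma cycle_4_index_iff: "i < 4 \<and> j < 4 \<and> (j = Suc i mod 4 \<or> i = Suc j mod 4) \<longleftrightarrow>
      (i, j) \<in> {0, 2} \<times> {1, 3 :: nat} \<union> {1, 3} \<times> {0, 2}"
proof (cases "i < 4 \<and> j < 4")
  case True
  then show ?thesis
    unfolding less_4 by (elim conjE disjE) simp_all
next
  case False
  then show ?thesis by auto
qed

lemma setcompr_eq_map_prod_image: "{(f i, g j) | i j. (i, j) \<in> S} = map_prod f g ` S"
  by force

lemma path_4_arcs:
  "{([a, b, c, d] ! i, [a, b, c, d] ! j) | i j. i < 4 \<and> j < 4 \<and> (j = Suc i \<or> i = Suc j)} =
     {(a, b), (b, a), (b, c), (c, b), (c, d), (d, c)}"
  unfolding path_4_index_iff setcompr_eq_map_prod_image by (simp add: numeral_3_eq_3)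

text \<open>The 4-cycle is the complete bipartite graph on its two pairs of opposite vertices.\<close>
lemma cycle_4_arcs:
  "{([a, b, c, d] ! i, [a, b, c, d] ! j) | i j.
      i < 4 \<and> j < 4 \<and> (j = Suc i mod 4 \<or> i = Suc j mod 4)} =
     {a, c} \<times> {b, d} \<union> {b, d} \<times> {a, c}"
  unfolding cycle_4_index_iff setcompr_eq_map_prod_image
  by (simp add: image_Un map_prod_surj_on[OF refl refl] numeral_3_eq_3)

lemma cographI:
  assumes "graph \<Gamma>"
    and no_path: "\<And>a b c d. distinct [a, b, c, d] \<Longrightarrow> {a, b, c, d} \<subseteq> verts \<Gamma> \<Longrightarrow>
      a \<rightarrow>\<^bsub>\<Gamma>\<^esub> b \<Longrightarrow> b \<rightarrow>\<^bsub>\<Gamma>\<^esub> c \<Longrightarrow> c \<rightarrow>\<^bsub>\<Gamma>\<^esub> d \<Longrightarrow>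
      \<not> a \<rightarrow>\<^bsub>\<Gamma>\<^esub> c \<Longrightarrow> \<not> b \<rightarrow>\<^bsub>\<Gamma>\<^esub> d \<Longrightarrow> \<not> a \<rightarrow>\<^bsub>\<Gamma>\<^esub> d \<Longrightarrow> False"
  shows "cograph \<Gamma>"
proof -
  have False if P: "induced_subgraph P \<Gamma>" and path: "path_graph 4 P" for P
  proof -
    from path obtain xs where xs: "distinct xs" "length xs = 4" "verts P = set xs"
      and ends: "arcs_ends P = {(xs ! i, xs ! j) | i j. i < 4 \<and> j < 4 \<and> (j = Suc i \<or> i = Suc j)}"
      unfolding path_graph_def by (elim conjE exE)
    obtain a b c d where abcd: "xs = [a, b, c, d]"
      using xs(2) by (auto simp: numeral_eq_Suc length_Suc_conv)
    have ends': "arcs_ends P = {(a, b), (b, a), (b, c), (c, b), (c, d), (d, c)}"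
      unfolding ends abcd by (rule path_4_arcs)
    have "compatible \<Gamma> P" "verts P \<subseteq> verts \<Gamma>"
      and arcs: "arcs P = {e \<in> arcs \<Gamma>. tail \<Gamma> e \<in> verts P \<and> head \<Gamma> e \<in> verts P}"
      using P by (auto simp: induced_subgraph_def subgraph_def)
    then have iff: "u \<rightarrow>\<^bsub>\<Gamma>\<^esub> v \<longleftrightarrow> u \<rightarrow>\<^bsub>P\<^esub> v" if "u \<in> verts P" "v \<in> verts P" for u v
      using that by (auto simp: arcs_ends_conv compatible_def arcs)
    show False
      using xs \<open>verts P \<subseteq> verts \<Gamma>\<close> by (intro no_path[of a b c d]) (auto simp: abcd iff ends')
  qed
  then show ?thesis
    unfolding cograph_def using \<open>graph \<Gamma>\<close> by blast
qed

lemma cograph_no_induced_path: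
  assumes "cograph \<Gamma>"
    and abcd: "distinct [a, b, c, d]" "{a, b, c, d} \<subseteq> verts \<Gamma>"
    and adj: "a \<rightarrow>\<^bsub>\<Gamma>\<^esub> b" "b \<rightarrow>\<^bsub>\<Gamma>\<^esub> c" "c \<rightarrow>\<^bsub>\<Gamma>\<^esub> d"
    and nonadj: "\<not> a \<rightarrow>\<^bsub>\<Gamma>\<^esub> c" "\<not> b \<rightarrow>\<^bsub>\<Gamma>\<^esub> d" "\<not> a \<rightarrow>\<^bsub>\<Gamma>\<^esub> d"
  shows False
proof -
  interpret graph \<Gamma>
    using assms(1) by (simp add: cograph_def)
  let ?P = "\<Gamma> \<restriction> {a, b, c, d}"
  have sym: "u \<rightarrow>\<^bsub>\<Gamma>\<^esub> v \<Longrightarrow> v \<rightarrow>\<^bsub>\<Gamma>\<^esub> u" for u v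
    using sym_arcs by (auto simp: symmetric_def dest: symD)
  have irr: "\<not> u \<rightarrow>\<^bsub>\<Gamma>\<^esub> u" for u
    using no_loops by (auto simp: arcs_ends_conv)
  have "arcs_ends ?P = {(u, v). u \<rightarrow>\<^bsub>\<Gamma>\<^esub> v \<and> u \<in> {a, b, c, d} \<and> v \<in> {a, b, c, d}}"
    by (auto simp: arcs_ends_conv image_iff)
  also have "\<dots> = {(a, b), (b, a), (b, c), (c, b), (c, d), (d, c)}" (is "?L = ?R")
  proof
    show "?L \<subseteq> ?R"
      using irr nonadj nonadj[THEN contrapos_nn, OF sym] by auto
    show "?R \<subseteq> ?L"
      using adj adj[THEN sym] by simp
  qed
  finally have ends: "arcs_ends ?P = {(a, b), (b, a), (b, c), (c, b), (c, d), (d, c)}" .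
  have ind: "induced_subgraph ?P \<Gamma>"
    using abcd(2) by (rule induced_induce)
  interpret P: sym_digraph ?P
    by (rule induced_graph_imp_graph[OF ind])
  have "graph ?P"
    by unfold_locales (auto simp: no_loops dest: no_multi_arcs)
  then have "path_graph 4 ?P"
    unfolding path_graph_def ends path_4_arcs[symmetric]
    using abcd(1) by (intro conjI exI[of _ "[a, b, c, d]"]) simp_all
  then show False
    using assms(1) ind unfolding cograph_def by blast
qed

lemma cograph_star:
  assumes "star_graph \<Gamma>"
  shows "cograph \<Gamma>"
proof -
  obtain U V where UV: "U \<inter> V = {}" "card U = 1"
    "arcs_ends \<Gamma> = U \<times> V \<union> V \<times> U" and "graph \<Gamma>"
    using assms unfolding star_graph_def complete_bipartite_digraph_def by blast
  obtain u where "U = {u}"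
    using UV(2) by (auto simp: card_1_singleton_iff)
  then show ?thesis
    using \<open>graph \<Gamma>\<close> UV by (intro cographI) auto
qed

lemma cograph_path_3:
  assumes "path_graph 3 \<Gamma>"
  shows "cograph \<Gamma>"
proof -
  obtain xs where xs: "length xs = 3" "verts \<Gamma> = set xs" and "graph \<Gamma>"
    using assms unfolding path_graph_def by blast
  have False if "distinct [a, b, c, d]" "{a, b, c, d} \<subseteq> verts \<Gamma>" for a b c d
  proof -
    have "card (set [a, b, c, d]) \<le> card (verts \<Gamma>)"
      using that(2) by (intro card_mono) (auto simp: xs(2))
    also have "\<dots> \<le> 3"
      using card_length[of xs] by (simp add: xs)
    finally show False
      using distinct_card[OF that(1)] by simp
  qed
  then show ?thesis
    using \<open>graph \<Gamma>\<close> by (intro cographI)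
qed

lemma cograph_cycle_4:
  assumes "cycle_graph 4 \<Gamma>"
  shows "cograph \<Gamma>"
proof -
  obtain xs where xs: "length xs = 4" and "graph \<Gamma>"
    and ends: "arcs_ends \<Gamma> = {(xs ! i, xs ! j) | i j.
      i < 4 \<and> j < 4 \<and> (j = Suc i mod 4 \<or> i = Suc j mod 4)}"
    using assms unfolding cycle_graph_def by blast
  obtain a b c d where abcd: "xs = [a, b, c, d]"
    using xs by (auto simp: numeral_eq_Suc length_Suc_conv)
  show ?thesis
    using \<open>graph \<Gamma>\<close>
    by (rule cographI) (unfold ends abcd cycle_4_arcs, blast)
qed

section \<open>Subgroups of finite cyclic groups\<close>

lemma div_div_self:
  fixes d n :: nat
  assumes "d dvd n" "0 < n"
  shows "n div (n div d) = d"
proof -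
  obtain m where "n = d * m" using assms(1) by blast
  then show ?thesis using assms(2) by simp
qed

locale finite_group = group +
  assumes finite_carrier: "finite (carrier G)"
begin

lemma finite_subgroup: "subgroup H G \<Longrightarrow> finite H"
  using finite_carrier finite_subset subgroup.subset by blast

lemma card_subgroup_pos: "subgroup H G \<Longrightarrow> 0 < card H"
  by (metis card_gt_0_iff empty_iff finite_subgroup subgroup.one_closed)

lemma card_subgroup_dvd:
  assumes "subgroup H G" "subgroup K G" "H \<subseteq> K"
  shows "card H dvd card K"
proof -
  have "subgroup H (G\<lparr>carrier := K\<rparr>)"
    using assms subgroup_incl by blast
  then have "card (rcosets\<^bsub>G\<lparr>carrier := K\<rparr>\<^esub> H) * card H = order (G\<lparr>carrier := K\<rparr>)"
    by (rule group.lagrange[OF subgroup_imp_group[OF assms(2)]])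
  then have "card (rcosets\<^bsub>G\<lparr>carrier := K\<rparr>\<^esub> H) * card H = card K"
    by (simp add: order_def)
  then show ?thesis
    by (metis dvd_triv_right)
qed

lemma cyclic_subgroups_iff:
  "H \<in> cyclic_subgroups G \<longleftrightarrow> (\<exists>x \<in> carrier G. H = generate G {x})"
proof -
  have gen: "subgroup_generated (G\<lparr>carrier := H\<rparr>) {x} = G\<lparr>carrier := generate G {x}\<rparr>"
    if "subgroup H G" "x \<in> H" for H x
    using generate_consistent[of "{x}" H] that by (simp add: subgroup_generated_def)
  show ?thesis
  proof
    assume "H \<in> cyclic_subgroups G"
    then obtain x where x: "subgroup H G" "x \<in> H" "subgroup_generated (G\<lparr>carrier := H\<rparr>) {x} = G\<lparr>carrier := H\<rparr>"
      by (auto simp: cyclic_subgroups_def cyclic_group_def)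
    then have "carrier (G\<lparr>carrier := generate G {x}\<rparr>) = carrier (G\<lparr>carrier := H\<rparr>)"
      using gen by metis
    then show "\<exists>x \<in> carrier G. H = generate G {x}"
      using x subgroup.mem_carrier by fastforce
  next
    assume "\<exists>x \<in> carrier G. H = generate G {x}"
    then obtain x where x: "x \<in> carrier G" "H = generate G {x}" by blast
    have H: "subgroup H G" "x \<in> H"
      using x by (auto intro: generate_is_subgroup generate.incl)
    then show "H \<in> cyclic_subgroups G"
      using gen[OF H] x(2) by (auto simp: cyclic_subgroups_def cyclic_group_def)
  qed
qed

lemma cyclic_subgroup_is_subgroup: "H \<in> cyclic_subgroups G \<Longrightarrow> subgroup H G"
  by (simp add: cyclic_subgroups_def)

text \<open>
  A subgroup \<open>K\<close> of a cyclic group generated by \<open>x\<close> is determined by its order \<open>k\<close>: by Lagrange,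
  each of its elements \<open>x [^] i\<close> satisfies \<open>ord x dvd i * k\<close>, so it is a power of
  \<open>x [^] (ord x div k)\<close>, and the group generated by the latter has order \<open>k\<close> as well.
\<close>
lemma subgroup_of_cyclic_eq_generate:
  assumes x: "x \<in> carrier G" and K: "subgroup K G" "K \<subseteq> generate G {x}"
  shows "K = generate G {x [^] (ord x div card K)}"
proof -
  let ?k = "card K" and ?n = "ord x"
  let ?y = "x [^] (?n div ?k)"
  have "subgroup (generate G {x}) G"
    using x by (simp add: generate_is_subgroup)
  then have dvd: "?k dvd ?n"
    using card_subgroup_dvd[OF K(1) _ K(2)] generate_pow_card[OF x] by simp
  have n: "?n > 0"
    using ord_ge_1[OF finite_carrier x] by simp
  have k: "?k > 0" by (rule card_subgroup_pos[OF K(1)])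
  have y: "?y \<in> carrier G" using x by simp
  have "K \<subseteq> generate G {?y}"
  proof
    fix z assume z: "z \<in> K"
    then obtain i :: nat where i: "z = x [^] i"
      using K(2) generate_pow_on_finite_carrier[OF finite_carrier x] by auto
    have "z [^]\<^bsub>G\<lparr>carrier := K\<rparr>\<^esub> order (G\<lparr>carrier := K\<rparr>) = \<one>\<^bsub>G\<lparr>carrier := K\<rparr>\<^esub>"
      using group.pow_order_eq_1[OF subgroup_imp_group[OF K(1)]] z by simp
    then have "z [^] ?k = \<one>"
      by (simp add: order_def nat_pow_consistent[symmetric])
    then have "?n dvd i * ?k"
      using x i by (simp add: nat_pow_pow pow_eq_id)
    moreover obtain m where m: "?n = ?k * m"
      using dvd by blast
    ultimately have "?n div ?k dvd i"
      using k by (simp add: mult.commute)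
    then obtain j where "i = ?n div ?k * j" by blast
    then have "z = ?y [^] j"
      using i x by (simp add: nat_pow_pow)
    then show "z \<in> generate G {?y}"
      using generate_pow_on_finite_carrier[OF finite_carrier y] by blast
  qed
  moreover have "card (generate G {?y}) = ?k"
  proof -
    have "ord ?y = ?n div (?n div ?k)"
      using dvd n x by (intro ord_pow) (auto simp: dvd_div_eq_0_iff)
    also have "\<dots> = ?k"
      using dvd n by (rule div_div_self)
    finally show ?thesis
      using generate_pow_card[OF y] by simp
  qed
  moreover have "finite (generate G {?y})"
    using y by (intro finite_subgroup generate_is_subgroup) simp
  ultimately show ?thesis
    by (intro card_subset_eq) auto
qed

lemma subgroup_of_cyclic_mono:
  assumes C: "C \<in> cyclic_subgroups G"
    and K: "subgroup K G" "K \<subseteq> C" and L: "subgroup L G" "L \<subseteq> C"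
    and dvd: "card K dvd card L"
  shows "K \<subseteq> L"
proof -
  obtain x where x: "x \<in> carrier G" and Cx: "C = generate G {x}"
    using C cyclic_subgroups_iff by blast
  let ?k = "ord x div card K" and ?l = "ord x div card L"
  have "card L dvd ord x"
    using card_subgroup_dvd[OF L(1) cyclic_subgroup_is_subgroup[OF C] L(2)] generate_pow_card[OF x] Cx by simp
  then have "?k = ?l * (card L div card K)"
    using dvd card_subgroup_pos[OF L(1)] card_subgroup_pos[OF K(1)]
    by (simp add: div_mult_div_if_dvd div_mult_swap)
  then have k: "x [^] ?k = (x [^] ?l) [^] (card L div card K)"
    using x by (simp add: nat_pow_pow)
  have Lx: "L = generate G {x [^] ?l}"
    using subgroup_of_cyclic_eq_generate[OF x L(1)] L(2) Cx by simp
  then have "x [^] ?l \<in> L"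
    using generate.incl by fastforce
  then have "x [^] ?k \<in> L"
    unfolding k
    using monoid.nat_pow_closed[OF group.is_monoid[OF subgroup_imp_group[OF L(1)]]] \<open>x [^] ?l \<in> L\<close>
    by (simp add: nat_pow_consistent[symmetric])
  then have "generate G {x [^] ?k} \<subseteq> L"
    using L(1) by (intro generate_subgroup_incl) auto
  then show ?thesis
    using subgroup_of_cyclic_eq_generate[OF x K(1)] K(2) Cx by simp
qed

lemma subgroup_of_cyclic_exists:
  assumes C: "C \<in> cyclic_subgroups G" and d: "d dvd card C"
  obtains K where "K \<in> cyclic_subgroups G" "K \<subseteq> C" "card K = d"
proof -
  obtain x where x: "x \<in> carrier G" and Cx: "C = generate G {x}"
    using C cyclic_subgroups_iff by blast
  have card: "card C = ord x"
    using generate_pow_card[OF x] Cx by simp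
  have pos: "0 < ord x"
    using ord_ge_1[OF finite_carrier x] by simp
  let ?y = "x [^] (ord x div d)"
  have y: "?y \<in> carrier G" using x by simp
  have "ord ?y = ord x div (ord x div d)"
    using d card pos x by (intro ord_pow) (auto simp: dvd_div_eq_0_iff)
  also have "\<dots> = d"
    using d pos unfolding card by (rule div_div_self)
  finally have "card (generate G {?y}) = d"
    using generate_pow_card[OF y] by simp
  moreover have "?y \<in> C"
    using generate_pow_on_finite_carrier[OF finite_carrier x] Cx by blast
  then have "generate G {?y} \<subseteq> C"
    using cyclic_subgroup_is_subgroup[OF C] by (intro generate_subgroup_incl) auto
  moreover have "generate G {?y} \<in> cyclic_subgroups G"
    using y cyclic_subgroups_iff by blast
  ultimately show ?thesis
    using that by blast
qed

text \<open>
  Covering means prime index, for \<open>H\<close> below a cyclic subgroup \<open>C\<close>: if the index is a proper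
  multiple of a prime \<open>p\<close>, then the subgroup of \<open>C\<close> of order \<open>p * card H\<close> lies strictly between.
\<close>
lemma covers_subgroup_iff:
  assumes C: "C \<in> cyclic_subgroups G" and H: "subgroup H G"
  shows "covers_subgroup G H C \<longleftrightarrow> H \<subseteq> C \<and> (\<exists>p. prime p \<and> card C = p * card H)"
proof
  have sC: "subgroup C G" by (rule cyclic_subgroup_is_subgroup[OF C])
  note pos = card_subgroup_pos[OF sC] card_subgroup_pos[OF H]
  {
    assume cov: "covers_subgroup G H C"
    then have sub: "H \<subset> C" by (simp add: covers_subgroup_def)
    then obtain m where m: "card C = card H * m"
      using card_subgroup_dvd[OF H sC] by (auto elim!: dvdE)
    have "card H < card C"
      using sub finite_subgroup[OF sC] by (intro psubset_card_mono)
    then have "m \<noteq> 1" using m by auto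
    then obtain p where p: "prime p" "p dvd m"
      using prime_factor_nat by blast
    then have "p * card H dvd card C"
      using m by (simp add: mult.commute)
    then obtain K where K: "K \<in> cyclic_subgroups G" "K \<subseteq> C" "card K = p * card H"
      using subgroup_of_cyclic_exists[OF C] by metis
    have sK: "subgroup K G" by (rule cyclic_subgroup_is_subgroup[OF K(1)])
    have "H \<subseteq> K"
      using sub K by (intro subgroup_of_cyclic_mono[OF C H _ sK]) auto
    moreover have "card H \<noteq> card K"
      using K(3) pos p(1) by auto
    ultimately have "H \<subset> K" by auto
    then have "K = C"
      using cov sK K(2) by (auto simp: covers_subgroup_def)
    then show "H \<subseteq> C \<and> (\<exists>p. prime p \<and> card C = p * card H)"
      using sub K(3) p(1) by auto
  next
    assume "H \<subseteq> C \<and> (\<exists>p. prime p \<and> card C = p * card H)"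
    then obtain p where HC: "H \<subseteq> C" and p: "prime p" "card C = p * card H" by blast
    have "card H \<noteq> card C"
      using p pos by auto
    moreover have False if K: "subgroup K G" "H \<subset> K" "K \<subset> C" for K
    proof -
      obtain m where m: "card K = card H * m"
        using card_subgroup_dvd[OF H K(1)] K(2) by (auto elim!: dvdE)
      have "card K dvd card C"
        using card_subgroup_dvd[OF K(1) sC] K(3) by auto
      then have "m dvd p"
        using m p(2) pos by (simp add: mult.commute)
      moreover have "card H < card K" "card K < card C"
        using K finite_subgroup[OF sC] finite_subgroup[OF K(1)] by (auto intro: psubset_card_mono)
      ultimately show False
        using m p by (auto simp: prime_nat_iff)
    qed
    ultimately show "covers_subgroup G H C"
      using HC by (auto simp: covers_subgroup_def)
  }
qed

lemma card_eq_1_iff: "subgroup H G \<Longrightarrow> card H = 1 \<longleftrightarrow> H = {\<one>}"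
  using subgroup.one_closed[of H G] by (auto simp: card_1_singleton_iff)

lemma one_in_cyclic_subgroups: "{\<one>} \<in> cyclic_subgroups G"
  using cyclic_subgroups_iff generate_one by blast

end

section \<open>Numbers with few prime factors\<close>

lemma not_prime_mult:
  fixes m n :: nat
  assumes "1 < m" "1 < n"
  shows "\<not> prime (m * n)"
  using assms prime_product[of m n] by auto

lemma prime_times_prime_not_prime:
  fixes p q r :: nat
  assumes "prime p" "prime q" "prime r"
  shows "r \<noteq> p * q"
  using assms not_prime_mult[of p q] prime_gt_1_nat by blast

lemma nat_eq_prime_or_square:
  fixes c p :: nat
  assumes p: "\<And>r. prime r \<Longrightarrow> r dvd c \<Longrightarrow> r = p" and cube: "\<not> p * (p * p) dvd c"
  shows "c = 1 \<or> c = p \<or> c = p * p"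
proof (rule ccontr)
  assume c: "\<not> ?thesis"
  \<comment> \<open>Split off the prime factor \<open>p\<close> three times.\<close>
  then obtain m where m: "c = p * m" "m \<noteq> 1"
    using p prime_factor_nat[of c] by (metis dvdE mult.right_neutral)
  then obtain k where k: "m = p * k"
    using p prime_factor_nat[of m] by (metis dvdE dvd_mult)
  then have "k \<noteq> 1"
    using c m by auto
  then have "p dvd k"
    using p prime_factor_nat[of k] m k by (metis dvd_mult)
  then show False
    using cube m k by (auto simp: mult_dvd_mono)
qed

lemma nat_eq_prime_or_product:
  fixes c p q :: nat
  assumes pq: "\<And>r. prime r \<Longrightarrow> r dvd c \<Longrightarrow> r = p \<or> r = q"
    and sq: "\<not> p * p dvd c" "\<not> q * q dvd c"
  shows "c = 1 \<or> c = p \<or> c = q \<or> c = p * q"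
proof -
  \<comment> \<open>By symmetry in \<open>p\<close> and \<open>q\<close>, assume that the first of the two primes divides \<open>c\<close>.\<close>
  have *: "c = s \<or> c = s * t"
    if st: "\<And>r. prime r \<Longrightarrow> r dvd c \<Longrightarrow> r = s \<or> r = t"
      and sq: "\<not> s * s dvd c" "\<not> t * t dvd c" and "s dvd c" for s t
  proof (rule ccontr)
    assume c: "\<not> ?thesis"
    obtain m where m: "c = s * m" using \<open>s dvd c\<close> by blast
    have "\<not> s dvd m"
      using sq m by (auto simp: mult_dvd_mono)
    moreover have "m \<noteq> 1"
      using c m by auto
    ultimately have "t dvd m"
      using st prime_factor_nat[of m] m by (metis dvd_mult)
    then obtain k where k: "m = t * k" by blast
    have "k \<noteq> 1"
      using c m k by auto
    then have "s dvd k \<or> t dvd k"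
      using st prime_factor_nat[of k] m k by (metis dvd_mult)
    then show False
      using sq m k \<open>\<not> s dvd m\<close> by (metis dvd_mult dvd_mult_left mult_dvd_mono dvd_refl mult.commute)
  qed
  show ?thesis
  proof (cases "c = 1")
    case False
    then have "p dvd c \<or> q dvd c"
      using pq prime_factor_nat by metis
    then show ?thesis
      using *[of p q] *[of q p] pq sq by (auto simp: mult.commute)
  qed simp
qed

section \<open>Adjacency of cyclic subgroups\<close>

context finite_group
begin

abbreviation \<Gamma> :: "'a set pair_pre_digraph" where
  "\<Gamma> \<equiv> cyclic_subgroup_graph G"

text \<open>Adjacency is stated on \<open>parcs\<close>, to which the simplifier reduces \<open>arcs_ends\<close> of a pair digraph.\<close>
abbreviation adjacent :: "'a set \<Rightarrow> 'a set \<Rightarrow> bool" (infix "\<frown>" 50) where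
  "H \<frown> K \<equiv> (H, K) \<in> parcs \<Gamma>"

lemma graph_\<Gamma>: "graph \<Gamma>"
  by (rule graph_cyclic_subgroup_graph[OF finite_carrier])

lemma verts_\<Gamma>: "pverts \<Gamma> = cyclic_subgroups G"
  by (simp add: cyclic_subgroup_graph_def)

lemma adjacent_iff:
  "H \<frown> K \<longleftrightarrow> H \<in> cyclic_subgroups G \<and> K \<in> cyclic_subgroups G \<and>
     (H \<subseteq> K \<and> (\<exists>p. prime p \<and> card K = p * card H) \<or>
      K \<subseteq> H \<and> (\<exists>p. prime p \<and> card H = p * card K))"
proof -
  have "covers_subgroup G H K \<Longrightarrow> H \<noteq> K" for H K
    by (auto simp: covers_subgroup_def)
  then show ?thesis
    using covers_subgroup_iff[of H K] covers_subgroup_iff[of K H] cyclic_subgroup_is_subgroup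
    by (auto simp: cyclic_subgroup_graph_def)
qed

lemma adjacent_sym: "H \<frown> K \<Longrightarrow> K \<frown> H"
  by (auto simp: adjacent_iff)

lemma adjacent_irrefl: "\<not> H \<frown> H"
  by (auto simp: cyclic_subgroup_graph_def)

lemma adjacentI:
  assumes "H \<in> cyclic_subgroups G" "K \<in> cyclic_subgroups G" "H \<subseteq> K" "prime p" "card K = p * card H"
  shows "H \<frown> K" "K \<frown> H"
  using assms adjacent_iff by auto

lemma adjacent_card:
  assumes "H \<frown> K"
  shows "\<exists>p. prime p \<and> (card K = p * card H \<or> card H = p * card K)"
  using assms adjacent_iff by auto

lemma one_subset: "H \<in> cyclic_subgroups G \<Longrightarrow> {\<one>} \<subseteq> H"
  using cyclic_subgroup_is_subgroup subgroup.one_closed by blast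

lemma one_adjacent:
  assumes "H \<in> cyclic_subgroups G" "prime (card H)"
  shows "{\<one>} \<frown> H" "H \<frown> {\<one>}"
  using adjacentI[OF one_in_cyclic_subgroups assms(1) one_subset[OF assms(1)] assms(2)] by simp_all

lemma one_adjacentD:
  assumes "{\<one>} \<frown> H \<or> H \<frown> {\<one>}"
  shows "prime (card H)"
proof -
  have "{\<one>} \<frown> H"
    using assms adjacent_sym by blast
  then obtain p where p: "prime p" "card H = p \<or> p * card H = 1"
    using adjacent_card[of "{\<one>}" H] by fastforce
  then show ?thesis by auto
qed

lemma prime_not_adjacent:
  assumes "prime (card H)" "prime (card K)"
  shows "\<not> H \<frown> K"
proof
  assume "H \<frown> K"
  then obtain p where "prime p" "card K = p * card H \<or> card H = p * card K"
    using adjacent_card by blast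
  then show False
    using prime_times_prime_not_prime assms by blast
qed

lemma cyclic_card_inj:
  assumes "C \<in> cyclic_subgroups G" "H \<in> cyclic_subgroups G" "K \<in> cyclic_subgroups G"
    and "H \<subseteq> C" "K \<subseteq> C" "card H = card K"
  shows "H = K"
  using subgroup_of_cyclic_mono[of C H K] subgroup_of_cyclic_mono[of C K H]
    cyclic_subgroup_is_subgroup assms by auto

text \<open>
  The other vertices are assumed pairwise nonadjacent, which includes loops and pairs that are not
  vertices; for these the assumption holds automatically.
\<close>
lemma star_cyclic_subgroup_graph:
  assumes A: "A \<in> cyclic_subgroups G"
    and adj: "\<And>H. H \<in> cyclic_subgroups G \<Longrightarrow> H \<noteq> A \<Longrightarrow> A \<frown> H"
    and nonadj: "\<And>H K. H \<noteq> A \<Longrightarrow> K \<noteq> A \<Longrightarrow> \<not> H \<frown> K"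
  shows "star_graph \<Gamma>"
proof -
  let ?V = "cyclic_subgroups G - {A}"
  have "H \<frown> K \<longleftrightarrow> (H, K) \<in> {A} \<times> ?V \<union> ?V \<times> {A}" for H K
  proof
    assume HK: "H \<frown> K"
    then have "H = A \<or> K = A" "H \<noteq> K" "H \<in> cyclic_subgroups G" "K \<in> cyclic_subgroups G"
      using nonadj adjacent_irrefl adjacent_iff by metis+
    then show "(H, K) \<in> {A} \<times> ?V \<union> ?V \<times> {A}" by auto
  next
    assume "(H, K) \<in> {A} \<times> ?V \<union> ?V \<times> {A}"
    then show "H \<frown> K" using adj adjacent_sym[of A H] by auto
  qed
  then have arcs: "parcs \<Gamma> = {A} \<times> ?V \<union> ?V \<times> {A}"
    by (intro Set.set_eqI) (simp only: split_paired_all)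
  have star: "verts \<Gamma> = {A} \<union> ?V \<and> {A} \<inter> ?V = {} \<and> card {A} = 1 \<and> card ?V = card ?V \<and>
      arcs_ends \<Gamma> = {A} \<times> ?V \<union> ?V \<times> {A}"
    using A by (simp add: verts_\<Gamma> arcs insert_absorb)
  have "K\<^bsub>1,card ?V\<^esub> \<Gamma>"
    unfolding complete_bipartite_digraph_def
    by (rule conjI[OF graph_\<Gamma>], rule exI[of _ "{A}"], rule exI[of _ ?V], rule star)
  then show ?thesis
    unfolding star_graph_def by (rule exI)
qed

lemma star_if_prime_cards:
  assumes "\<And>H. H \<in> cyclic_subgroups G \<Longrightarrow> card H = 1 \<or> prime (card H)"
  shows "star_graph \<Gamma>"
proof (rule star_cyclic_subgroup_graph)
  fix H assume H: "H \<in> cyclic_subgroups G" "H \<noteq> {\<one>}"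
  then have "prime (card H)"
    using assms card_eq_1_iff cyclic_subgroup_is_subgroup by blast
  then show "{\<one>} \<frown> H"
    using H(1) by (intro one_adjacent)
next
  fix H K assume ne: "H \<noteq> {\<one>}" "K \<noteq> {\<one>}"
  show "\<not> H \<frown> K"
  proof
    assume HK: "H \<frown> K"
    then have "prime (card H)" "prime (card K)"
      using assms card_eq_1_iff cyclic_subgroup_is_subgroup ne adjacent_iff by metis+
    then show False
      using prime_not_adjacent HK by blast
  qed
qed (rule one_in_cyclic_subgroups)

end

section \<open>Cyclic subgroup graphs that are cographs\<close>

text \<open>A finite group whose cyclic subgroup graph is a cograph.\<close>
locale cyclic_cograph = finite_group +
  assumes cograph: "cograph \<Gamma>"
begin

lemma no_induced_path:
  assumes "a \<frown> b" "b \<frown> c" "c \<frown> d"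
    and "\<not> a \<frown> c" "\<not> b \<frown> d" "\<not> a \<frown> d"
  shows False
proof -
  have "distinct [a, b, c, d]"
    using assms adjacent_irrefl adjacent_sym by auto
  moreover have "{a, b, c, d} \<subseteq> verts \<Gamma>"
    using assms(1,3) by (simp add: adjacent_iff verts_\<Gamma>)
  ultimately show False
    using assms by (intro cograph_no_induced_path[OF cograph, of a b c d]) simp_all
qed

end

text \<open>
  The case in which some cyclic subgroup is neither trivial nor of prime order, with a chosen chain
  \<open>1 \<subset> A \<subset> B\<close> of cyclic subgroups of prime indices \<open>p\<close> and \<open>r\<close>, possibly equal.
\<close>
locale cyclic_cograph_prime_chain = cyclic_cograph +
  fixes A B p r
  assumes A: "A \<in> cyclic_subgroups G" "card A = p" "prime p"
    and B: "B \<in> cyclic_subgroups G" "card B = p * r" "prime r"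
    and AB: "A \<subseteq> B"
begin

lemma not_prime: "\<not> prime (card B)"
  using not_prime_mult[of p r] A(3) B(2,3) prime_gt_1_nat by simp

text \<open>Otherwise \<open>D, 1, A, B\<close> is an induced path.\<close>
lemma prime_order_subset:
  assumes D: "D \<in> cyclic_subgroups G" "prime (card D)"
  shows "D \<subseteq> B"
proof (rule ccontr)
  assume DB: "\<not> D \<subseteq> B"
  show False
  proof (rule no_induced_path[of D "{\<one>}" A B])
    show "D \<frown> {\<one>}" "{\<one>} \<frown> A"
      using one_adjacent A D by simp_all
    show "A \<frown> B"
      using adjacentI(1)[OF A(1) B(1) AB B(3)] A(2) B(2) by (simp add: mult.commute)
    show "\<not> D \<frown> A"
      using prime_not_adjacent[of D A] A(2,3) D(2) by simp
    show "\<not> {\<one>} \<frown> B"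
      using one_adjacentD[of B] not_prime by blast
    show "\<not> D \<frown> B"
    proof
      assume "D \<frown> B"
      then have "card B dvd card D"
        using DB by (auto simp: adjacent_iff)
      then have "card B = 1 \<or> card B = card D"
        using D(2) by (simp add: prime_nat_iff)
      moreover have "card B \<noteq> 1"
        using B(2,3) by auto
      ultimately show False
        using D(2) not_prime by auto
    qed
  qed
qed

lemma prime_order_unique:
  assumes "D \<in> cyclic_subgroups G" "E \<in> cyclic_subgroups G" "prime (card D)" "card E = card D"
  shows "E = D"
  using assms prime_order_subset by (intro cyclic_card_inj[of B]) (auto simp: B)

text \<open>The subgroup of order \<open>card D\<close> inside \<open>C\<close> must be \<open>D\<close> itself, by uniqueness.\<close>
lemma prime_order_subset_if_dvd:
  assumes D: "D \<in> cyclic_subgroups G" "prime (card D)"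
    and C: "C \<in> cyclic_subgroups G" "card D dvd card C"
  shows "D \<subseteq> C"
proof -
  obtain E where "E \<in> cyclic_subgroups G" "E \<subseteq> C" "card E = card D"
    using subgroup_of_cyclic_exists[OF C] by blast
  then show ?thesis
    using prime_order_unique[OF D(1)] D(2) by blast
qed

lemma prime_dvd_card:
  assumes C: "C \<in> cyclic_subgroups G" and q: "prime q" "q dvd card C"
  shows "q = p \<or> q = r"
proof -
  obtain D where D: "D \<in> cyclic_subgroups G" "card D = q"
    using subgroup_of_cyclic_exists[OF C q(2)] by blast
  then have "q dvd p * r"
    using card_subgroup_dvd[of D B] prime_order_subset[of D] cyclic_subgroup_is_subgroup B q(1) by metis
  then show ?thesis
    using q(1) A(3) B(3) by (metis prime_dvd_mult_iff primes_dvd_imp_eq)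
qed

text \<open>
  Otherwise there are cyclic subgroups \<open>K \<subseteq> L\<close> of orders \<open>p * p\<close> and \<open>p * (p * p)\<close>, and
  \<open>1, A, K, L\<close> is an induced path.
\<close>
lemma no_cube:
  assumes C: "C \<in> cyclic_subgroups G"
  shows "\<not> p * (p * p) dvd card C"
proof
  assume "p * (p * p) dvd card C"
  then obtain L where L: "L \<in> cyclic_subgroups G" "card L = p * (p * p)"
    using subgroup_of_cyclic_exists[OF C] by metis
  then obtain K where K: "K \<in> cyclic_subgroups G" "K \<subseteq> L" "card K = p * p"
    using subgroup_of_cyclic_exists[OF L(1), of "p * p"] by auto
  have p1: "1 < p" using A(3) by (rule prime_gt_1_nat)
  have pp: "1 < p * p" using less_1_mult[OF p1 p1] .
  show False
  proof (rule no_induced_path[of "{\<one>}" A K L])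
    show "{\<one>} \<frown> A"
      using A by (intro one_adjacent) simp_all
    show "A \<frown> K"
      using A K by (intro adjacentI(1)[where p = p] prime_order_subset_if_dvd) auto
    show "K \<frown> L"
      using K L A(3) by (intro adjacentI(1)[where p = p]) auto
    show "\<not> {\<one>} \<frown> K"
      using one_adjacentD[of K] K(3) not_prime_mult[OF p1 p1] by auto
    show "\<not> A \<frown> L"
    proof
      assume "A \<frown> L"
      then obtain s where s: "prime s" "p * (p * p) = s * p \<or> p = s * (p * (p * p))"
        using adjacent_card[of A L] A(2) L(2) by auto
      then have "s = p * p \<or> s * (p * p) = 1"
        using p1 by auto
      then show False
        using s(1) p1 not_prime_mult[OF p1 p1] by auto
    qed
    show "\<not> {\<one>} \<frown> L"
      using one_adjacentD[of L] L(2) not_prime_mult[OF p1 pp] by auto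
  qed
qed

lemma star_if_prime_square:
  assumes "p = r"
  shows "star_graph \<Gamma>"
proof -
  have cards: "card H = 1 \<or> card H = p \<or> card H = p * p" if "H \<in> cyclic_subgroups G" for H
    using that prime_dvd_card no_cube assms by (intro nat_eq_prime_or_square) auto
  have p1: "1 < p" using A(3) by (rule prime_gt_1_nat)
  have cards': "card H = 1 \<or> card H = p * p" if "H \<in> cyclic_subgroups G" "H \<noteq> A" for H
    using cards[OF that(1)] prime_order_unique[of A H] that A by auto
  show ?thesis
  proof (rule star_cyclic_subgroup_graph)
    fix H assume H: "H \<in> cyclic_subgroups G" "H \<noteq> A"
    from cards'[OF H] show "A \<frown> H"
    proof
      assume "card H = 1"
      then have "H = {\<one>}"
        using card_eq_1_iff cyclic_subgroup_is_subgroup H(1) by blast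
      then show ?thesis
        using one_adjacent A by simp
    next
      assume "card H = p * p"
      then show ?thesis
        using H A by (intro adjacentI(1)[where p = p] prime_order_subset_if_dvd) auto
    qed
  next
    fix H K assume ne: "H \<noteq> A" "K \<noteq> A"
    show "\<not> H \<frown> K"
    proof
      assume HK: "H \<frown> K"
      then have "card H = 1 \<or> card H = p * p" "card K = 1 \<or> card K = p * p"
        using cards' ne adjacent_iff by metis+
      moreover have "\<not> prime (p * p)"
        using not_prime_mult[OF p1 p1] .
      ultimately show False
        using adjacent_card[OF HK] p1 by auto
    qed
  qed (rule A)
qed

text \<open>
  Otherwise a cyclic subgroup \<open>K\<close> of order \<open>card D * card D\<close> exists, and \<open>K, D, 1, E\<close> is an
  induced path.
\<close>
lemma no_square:
  assumes D: "D \<in> cyclic_subgroups G" "prime (card D)" and E: "E \<in> cyclic_subgroups G" "prime (card E)"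
    and ne: "card D \<noteq> card E" and C: "C \<in> cyclic_subgroups G"
  shows "\<not> card D * card D dvd card C"
proof
  assume "card D * card D dvd card C"
  then obtain K where K: "K \<in> cyclic_subgroups G" "card K = card D * card D"
    using subgroup_of_cyclic_exists[OF C] by metis
  have D1: "1 < card D"
    using prime_gt_1_nat[OF D(2)] .
  have not_prime: "\<not> prime (card D * card D)"
    using not_prime_mult[OF D1 D1] .
  show False
  proof (rule no_induced_path[of K D "{\<one>}" E])
    show "K \<frown> D"
      using D K by (intro adjacentI(2)[where p = "card D"] prime_order_subset_if_dvd) auto
    show "D \<frown> {\<one>}"
      using D by (intro one_adjacent)
    show "{\<one>} \<frown> E"
      using E by (intro one_adjacent)
    show "\<not> K \<frown> {\<one>}"
      using one_adjacentD[of K] K(2) not_prime by auto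
    show "\<not> D \<frown> E"
      using prime_not_adjacent D(2) E(2) by blast
    show "\<not> K \<frown> E"
    proof
      assume "K \<frown> E"
      then obtain s where s: "prime s" "card E = s * card K \<or> card K = s * card E"
        using adjacent_card by blast
      have "\<not> card E dvd card D * card D"
        using primes_dvd_imp_eq[OF E(2) D(2)] ne E(2) by (auto simp: prime_dvd_mult_iff)
      moreover have "\<not> card D dvd card E"
        using primes_dvd_imp_eq[OF D(2) E(2)] ne by auto
      ultimately show False
        using s(2) K(2) by auto
    qed
  qed
qed

lemma cycle_if_distinct_primes:
  assumes ne: "p \<noteq> r"
  shows "cycle_graph 4 \<Gamma>"
proof -
  obtain D where D: "D \<in> cyclic_subgroups G" "D \<subseteq> B" "card D = r"
    using subgroup_of_cyclic_exists[OF B(1), of r] B(2) by auto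
  have p1: "1 < p" and r1: "1 < r"
    using prime_gt_1_nat[OF A(3)] prime_gt_1_nat[OF B(3)] .
  have cards: "card H = 1 \<or> card H = p \<or> card H = r \<or> card H = p * r"
    if "H \<in> cyclic_subgroups G" for H
    using that prime_dvd_card no_square[OF A(1) _ D(1)] no_square[OF D(1) _ A(1)] A B D ne
    by (intro nat_eq_prime_or_product) auto
  \<comment> \<open>\<open>A\<close> and \<open>D\<close> lie in \<open>H \<inter> B\<close>, so its order is divisible by \<open>p * r\<close>, the order of \<open>H\<close> and \<open>B\<close>.\<close>
  have top: "H = B" if H: "H \<in> cyclic_subgroups G" "card H = p * r" for H
  proof -
    have sub: "A \<subseteq> H" "D \<subseteq> H"
      using H A B D prime_order_subset_if_dvd by auto
    have S: "subgroup (H \<inter> B) G"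
      using H(1) B(1) cyclic_subgroup_is_subgroup by (intro subgroups_Inter_pair) auto
    have "p dvd card (H \<inter> B)" "r dvd card (H \<inter> B)"
      using card_subgroup_dvd[OF _ S] cyclic_subgroup_is_subgroup A D AB sub by auto
    then have "card B dvd card (H \<inter> B)"
      using ne A(3) B(2,3) by (simp add: divides_mult primes_coprime)
    then have "card B \<le> card (H \<inter> B)"
      using card_subgroup_pos[OF S] by (rule dvd_imp_le)
    moreover have "finite B" "finite H"
      using finite_subgroup cyclic_subgroup_is_subgroup H(1) B(1) by blast+
    ultimately have "B \<subseteq> H"
      using card_seteq[of B "H \<inter> B"] by auto
    then show ?thesis
      using card_seteq[of H B] \<open>finite H\<close> H(2) B(2) by simp
  qed
  have verts: "cyclic_subgroups G = {{\<one>}, A, B, D}"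
  proof
    show "cyclic_subgroups G \<subseteq> {{\<one>}, A, B, D}"
    proof
      fix H assume H: "H \<in> cyclic_subgroups G"
      then show "H \<in> {{\<one>}, A, B, D}"
        using cards[OF H] top[OF H] prime_order_unique[OF A(1) H] prime_order_unique[OF D(1) H]
          card_eq_1_iff cyclic_subgroup_is_subgroup A(2,3) B(3) D(3) by auto
    qed
  qed (use one_in_cyclic_subgroups A B D in auto)
  have adj:
    "{\<one>} \<frown> A" "A \<frown> {\<one>}" "{\<one>} \<frown> D" "D \<frown> {\<one>}"
    "A \<frown> B" "B \<frown> A" "D \<frown> B" "B \<frown> D"
    using one_adjacent[OF A(1)] one_adjacent[OF D(1)] A(3) B(3)
      adjacentI[OF A(1) B(1) AB B(3)] adjacentI[OF D(1) B(1) D(2) A(3)] A(2) B(2) D(3)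
    by (simp_all add: mult.commute)
  have nonadj: "\<not> {\<one>} \<frown> B" "\<not> B \<frown> {\<one>}" "\<not> A \<frown> D" "\<not> D \<frown> A"
    using one_adjacentD[of B] not_prime prime_not_adjacent[of A D] prime_not_adjacent[of D A]
      A(2,3) B(3) D(3) by auto
  have in_verts: "H \<in> {{\<one>}, A, B, D}" "K \<in> {{\<one>}, A, B, D}" if "H \<frown> K" for H K
    using that by (auto simp: adjacent_iff simp flip: verts)
  have "H \<frown> K \<longleftrightarrow> (H, K) \<in> {{\<one>}, B} \<times> {A, D} \<union> {A, D} \<times> {{\<one>}, B}" for H K
  proof
    assume "H \<frown> K"
    with in_verts[OF this] show "(H, K) \<in> {{\<one>}, B} \<times> {A, D} \<union> {A, D} \<times> {{\<one>}, B}"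
      using nonadj adjacent_irrefl by blast
  next
    assume "(H, K) \<in> {{\<one>}, B} \<times> {A, D} \<union> {A, D} \<times> {{\<one>}, B}"
    then show "H \<frown> K"
      using adj by blast
  qed
  then have ends: "parcs \<Gamma> = {{\<one>}, B} \<times> {A, D} \<union> {A, D} \<times> {{\<one>}, B}"
    by (intro Set.set_eqI) (simp only: split_paired_all)
  \<comment> \<open>The four vertices have the distinct orders \<open>1\<close>, \<open>p\<close>, \<open>p * r\<close> and \<open>r\<close>.\<close>
  have "distinct (map card [{\<one>}, A, B, D])"
    using A(2) B(2) D(3) p1 r1 ne by auto
  then have "distinct [{\<one>}, A, B, D]"
    using distinct_map by blast
  then show ?thesis
    unfolding cycle_graph_def with_proj_simps ends cycle_4_arcs[symmetric] verts_\<Gamma> verts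
    using graph_\<Gamma> by (intro conjI exI[of _ "[{\<one>}, A, B, D]"]) auto
qed

end

lemma (in cyclic_cograph) star_or_cycle:
  "star_graph \<Gamma> \<or> cycle_graph 4 \<Gamma>"
proof (cases "\<forall>H \<in> cyclic_subgroups G. card H = 1 \<or> prime (card H)")
  case True
  then show ?thesis
    using star_if_prime_cards by blast
next
  case False
  then obtain C where C: "C \<in> cyclic_subgroups G" "card C \<noteq> 1" "\<not> prime (card C)" by blast
  obtain p m where p: "prime p" and m: "card C = p * m"
    using prime_factor_nat[OF C(2)] by blast
  have "m \<noteq> 1"
    using C(3) p m by auto
  then obtain r where r: "prime r" "r dvd m"
    using prime_factor_nat by blast
  obtain B where B: "B \<in> cyclic_subgroups G" "card B = p * r"
    using subgroup_of_cyclic_exists[OF C(1), of "p * r"] m r(2) by auto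
  obtain A where A: "A \<in> cyclic_subgroups G" "A \<subseteq> B" "card A = p"
    using subgroup_of_cyclic_exists[OF B(1), of p] B(2) by auto
  interpret cyclic_cograph_prime_chain G A B p r
    by unfold_locales (use A B p r in auto)
  show ?thesis
    using star_if_prime_square cycle_if_distinct_primes by blast
qed

theorem lemma2p12:
  fixes G :: "('a, 'b) monoid_scheme"
  assumes "group G" and "finite (carrier G)"
  shows "cograph (cyclic_subgroup_graph G) \<longleftrightarrow>
           star_graph (cyclic_subgroup_graph G) \<or>
           path_graph 3 (cyclic_subgroup_graph G) \<or>
           cycle_graph 4 (cyclic_subgroup_graph G)"
proof
  interpret finite_group G
    using assms by (intro finite_group.intro finite_group_axioms.intro)
  assume "cograph (cyclic_subgroup_graph G)"
  then interpret cyclic_cograph G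
    by unfold_locales
  show "star_graph (cyclic_subgroup_graph G) \<or> path_graph 3 (cyclic_subgroup_graph G) \<or>
      cycle_graph 4 (cyclic_subgroup_graph G)"
    using star_or_cycle by blast
qed (use cograph_star cograph_path_3 cograph_cycle_4 in blast)

end
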